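(* Suppose that $\Omega$ is bounded and $\Omega\cap\mathbb{R}^{n_1\times n_2\times n_3}_{++}$ is nonempty, and let $\{\varepsilon_k\}_{k=0}^{\infty}$, $\{\nu_k\}_{k=0}^{\infty}$, $\{\eta_k\}_{k=0}^{\infty}$, $\{\mu_k\}_{k=0}^{\infty}$ be four sequences of nonnegative scalars. Let $\{X^k\}$ and $\{\widetilde X^k\}$ be sequences generated by the inexact entropic proximal point algorithm (iEPPA) described in the context, with these parameter sequences, for solving $$\min_X\ \langle C,X\rangle\quad\text{s.t.}\quad X\in\Omega .$$ If $0<\underline{\varepsilon}\le\varepsilon_k\le\bar\varepsilon<\infty$ for all $k$ (for some constants $\underline{\varepsilon},\bar\varepsilon$), $\sum_k\nu_k<\infty$, $\sum_k\eta_k<\infty$ and $\sum_k\mu_k<\infty$, then $\{X^k\}$ and $\{\widetilde X^k\}$ converge to a same optimal solution of this problem.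
   Context: Setting. $\langle\cdot,\cdot\rangle$ is the standard (entrywise) inner product on $\mathbb{R}^{n_1\times n_2\times n_3}$ and $\|\cdot\|_F$ the induced (Frobenius) norm. $\mathbb{R}_{+}^{n_1\times n_2\times n_3}$ (resp. $\mathbb{R}_{++}^{n_1\times n_2\times n_3}$) is the set of tensors with nonnegative (resp. positive) entries. Given are $C\in\mathbb{R}^{n_1\times n_2\times n_3}$, an upper bound $U\in\mathbb{R}_+^{n_1\times n_2\times n_3}\cup\{\infty\}^{n_1\times n_2\times n_3}$, vectors $\boldsymbol{b}^{(i)}\in\mathbb{R}^{m_i}$, and linear maps $\mathcal{A}^{(i)}:\mathbb{R}^{n_1\times n_2\times n_3}\to\mathbb{R}^{m_i}$, $\mathcal{A}^{(i)}(X)=(\langle A^{(i)}_1,X\rangle,\dots,\langle A^{(i)}_{m_i},X\rangle)^{\top}$, $i=1,\dots,N$, where for each $i$ the tensors $A^{(i)}_j\in\mathbb{R}^{n_1\times n_2\times n_3}$ have only entries in $\{0,1\}$ and satisfy $A^{(i)}_j\circ A^{(i)}_k=0$ for $j\ne k$ ($\circ$ = Hadamard product). Define $$\Omega=\{X:\ \mathcal{A}^{(i)}(X)=\boldsymbol{b}^{(i)},\ i=1,\dots,N,\ 0\le X\le U\},\qquad \Omega^{\circ}=\{X:\ \mathcal{A}^{(i)}(X)=\boldsymbol{b}^{(i)},\ i=1,\dots,N,\ X\le U\}.$$ $\delta_{\Omega^\circ}$ is the indicator function of $\Omega^\circ$ ($0$ on $\Omega^\circ$, $+\infty$ elsewhere).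 For a proper closed convex function $f$, $\nu\ge 0$ and $X\in\mathrm{dom} f$, the $\nu$-subdifferential is $\partial_\nu f(X)=\{D:\ f(Y)\ge f(X)+\langle D,Y-X\rangle-\nu\ \ \forall Y\}$. Let $\phi(X)=\sum_{r,s,t}(X_{rst}\log X_{rst}-X_{rst})$ with $0\log 0=0$, so $\mathrm{dom}\,\phi=\mathbb{R}_+^{n_1\times n_2\times n_3}$ and $\nabla\phi(X)=\log X$ (entrywise) for $X\in\mathbb{R}^{n_1\times n_2\times n_3}_{++}$. The Bregman distance is $\mathcal{D}_\phi(X,Y)=\phi(X)-\phi(Y)-\langle\nabla\phi(Y),X-Y\rangle$ for $X\in\mathbb{R}_+^{n_1\times n_2\times n_3}$, $Y\in\mathbb{R}_{++}^{n_1\times n_2\times n_3}$. The iEPPA. Choose $X^0=\widetilde X^0\in\mathbb{R}_{++}^{n_1\times n_2\times n_3}$ arbitrarily. For $k=0,1,2,\dots$, find a pair $(X^{k+1},\widetilde X^{k+1})$ by approximately solving $\min_X\ \delta_{\Omega^\circ}(X)+\langle C,X\rangle+\varepsilon_k\mathcal{D}_\phi(X,X^k)$ in the sense that $X^{k+1}\in\mathbb{R}_{++}^{n_1\times n_2\times n_3}$, $\widetilde X^{k+1}\in\Omega$, and there is a tensor $\Delta^k$ with $$\Delta^k\in\partial_{\nu_k}\delta_{\Omega^\circ}(\widetilde X^{k+1})+C+\varepsilon_k\big(\nabla\phi(X^{k+1})-\nabla\phi(X^k)\big),\qquad \|\Delta^k\|_F\le\eta_k,\qquad \mathcal{D}_\phi(\widetilde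 X^{k+1},X^{k+1})\le\mu_k .$$ *)

theory Defs
  imports "HOL-Analysis.Analysis"
begin

(* The library inner product, norm and product on this type are the entrywise inner product,
   the Frobenius norm and the Hadamard product. *)
type_synonym ('n1, 'n2, 'n3) tensor = "real ^ 'n3 ^ 'n2 ^ 'n1"

definition nonneg_tensors :: "('n1::finite, 'n2::finite, 'n3::finite) tensor set" where
  "nonneg_tensors = {X. \<forall>r s t. 0 \<le> X $ r $ s $ t}"

definition pos_tensors :: "('n1::finite, 'n2::finite, 'n3::finite) tensor set" where
  "pos_tensors = {X. \<forall>r s t. 0 < X $ r $ s $ t}"

definition tensor_map ::
  "(nat \<Rightarrow> nat \<Rightarrow> ('n1::finite, 'n2::finite, 'n3::finite) tensor) \<Rightarrow> nat
    \<Rightarrow> ('n1, 'n2, 'n3) tensor \<Rightarrow> nat \<Rightarrow> real" where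
  "tensor_map A i X = (\<lambda>j. A i j \<bullet> X)"

(* There are N blocks of constraints; block i has m i of them, so that only the values A i j and
   b i j with 1 <= i <= N and 1 <= j <= m i matter. *)
definition relaxed_feasible ::
  "nat \<Rightarrow> (nat \<Rightarrow> nat) \<Rightarrow> (nat \<Rightarrow> nat \<Rightarrow> ('n1::finite, 'n2::finite, 'n3::finite) tensor)
    \<Rightarrow> (nat \<Rightarrow> nat \<Rightarrow> real) \<Rightarrow> ereal ^ 'n3 ^ 'n2 ^ 'n1 \<Rightarrow> ('n1, 'n2, 'n3) tensor set" where
  "relaxed_feasible N m A b U =
     {X. (\<forall>i\<in>{1..N}. \<forall>j\<in>{1..m i}. tensor_map A i X j = b i j) \<and>
         (\<forall>r s t. ereal (X $ r $ s $ t) \<le> U $ r $ s $ t)}"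

definition feasible ::
  "nat \<Rightarrow> (nat \<Rightarrow> nat) \<Rightarrow> (nat \<Rightarrow> nat \<Rightarrow> ('n1::finite, 'n2::finite, 'n3::finite) tensor)
    \<Rightarrow> (nat \<Rightarrow> nat \<Rightarrow> real) \<Rightarrow> ereal ^ 'n3 ^ 'n2 ^ 'n1 \<Rightarrow> ('n1, 'n2, 'n3) tensor set" where
  "feasible N m A b U =
     {X. (\<forall>i\<in>{1..N}. \<forall>j\<in>{1..m i}. tensor_map A i X j = b i j) \<and>
         X \<in> nonneg_tensors \<and>
         (\<forall>r s t. ereal (X $ r $ s $ t) \<le> U $ r $ s $ t)}"

definition set_indicator :: "'a set \<Rightarrow> 'a \<Rightarrow> ereal" where
  "set_indicator S X = (if X \<in> S then 0 else \<infinity>)"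

(* Intended for proper f and for X with f X < \<infinity>. *)
definition approx_subdiff :: "real \<Rightarrow> ('a::real_inner \<Rightarrow> ereal) \<Rightarrow> 'a \<Rightarrow> 'a set" where
  "approx_subdiff \<nu> f X = {D. \<forall>Y. f Y \<ge> f X + ereal (D \<bullet> (Y - X)) - ereal \<nu>}"

(* Intended for X in nonneg_tensors; a zero entry contributes 0. *)
definition entropy :: "('n1::finite, 'n2::finite, 'n3::finite) tensor \<Rightarrow> real" where
  "entropy X = (\<Sum>r\<in>UNIV. \<Sum>s\<in>UNIV. \<Sum>t\<in>UNIV.
     X $ r $ s $ t * ln (X $ r $ s $ t) - X $ r $ s $ t)"

definition entropy_grad ::
  "('n1::finite, 'n2::finite, 'n3::finite) tensor \<Rightarrow> ('n1, 'n2, 'n3) tensor" where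
  "entropy_grad X = (\<chi> r s t. ln (X $ r $ s $ t))"

lemma gderiv_entropy:
  fixes X :: "('n1::finite, 'n2::finite, 'n3::finite) tensor"
  assumes "X \<in> pos_tensors"
  shows "GDERIV entropy X :> entropy_grad X"
proof -
  have d: "((\<lambda>Y. Y $ r $ s $ t * ln (Y $ r $ s $ t) - Y $ r $ s $ t) has_derivative
      (\<lambda>h. h $ r $ s $ t * ln (X $ r $ s $ t))) (at X)" for r s t
  proof -
    have pos: "0 < X $ r $ s $ t"
      using assms by (simp add: pos_tensors_def)
    have "bounded_linear (\<lambda>Y::('n1, 'n2, 'n3) tensor. Y $ r $ s $ t)"
      by (intro bounded_linear_intros bounded_linear_compose[OF bounded_linear_vec_nth])
    then have c: "((\<lambda>Y. Y $ r $ s $ t) has_derivative (\<lambda>h. h $ r $ s $ t)) (at X)"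
      by (rule bounded_linear_imp_has_derivative)
    have "((\<lambda>x. x * ln x - x) has_real_derivative ln (X $ r $ s $ t)) (at (X $ r $ s $ t))"
      using pos by (auto intro!: derivative_eq_intros)
    then have e: "((\<lambda>x. x * ln x - x) has_derivative (\<lambda>h. h * ln (X $ r $ s $ t)))
        (at (X $ r $ s $ t))"
      by (simp add: has_field_derivative_def mult_commute_abs)
    show ?thesis
      using has_derivative_compose[OF c e] by simp
  qed
  show ?thesis
    unfolding gderiv_def entropy_def[abs_def]
    by (auto simp: inner_vec_def entropy_grad_def intro!: has_derivative_sum d)
qed

definition entropy_bregman ::
  "('n1::finite, 'n2::finite, 'n3::finite) tensor \<Rightarrow> ('n1, 'n2, 'n3) tensor \<Rightarrow> real" where
  "entropy_bregman X Y = entropy X - entropy Y - entropy_grad Y \<bullet> (X - Y)"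

definition iEPPA ::
  "nat \<Rightarrow> (nat \<Rightarrow> nat) \<Rightarrow> (nat \<Rightarrow> nat \<Rightarrow> ('n1::finite, 'n2::finite, 'n3::finite) tensor)
    \<Rightarrow> (nat \<Rightarrow> nat \<Rightarrow> real) \<Rightarrow> ereal ^ 'n3 ^ 'n2 ^ 'n1 \<Rightarrow> ('n1, 'n2, 'n3) tensor
    \<Rightarrow> (nat \<Rightarrow> real) \<Rightarrow> (nat \<Rightarrow> real) \<Rightarrow> (nat \<Rightarrow> real) \<Rightarrow> (nat \<Rightarrow> real)
    \<Rightarrow> (nat \<Rightarrow> ('n1, 'n2, 'n3) tensor) \<Rightarrow> (nat \<Rightarrow> ('n1, 'n2, 'n3) tensor) \<Rightarrow> bool" where
  "iEPPA N m A b U C \<epsilon> \<nu> \<eta> \<mu> X X' \<longleftrightarrow>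
     X 0 = X' 0 \<and> X 0 \<in> pos_tensors \<and>
     (\<forall>k. X (Suc k) \<in> pos_tensors \<and> X' (Suc k) \<in> feasible N m A b U \<and>
       (\<exists>\<Delta>. \<Delta> \<in> (\<lambda>D. D + C + \<epsilon> k *\<^sub>R (entropy_grad (X (Suc k)) - entropy_grad (X k))) `
                 approx_subdiff (\<nu> k) (set_indicator (relaxed_feasible N m A b U)) (X' (Suc k)) \<and>
            norm \<Delta> \<le> \<eta> k \<and>
            entropy_bregman (X' (Suc k)) (X (Suc k)) \<le> \<mu> k))"

end

theory Submission
  imports Defs
begin

text \<open>For \<open>Y\<close> in the feasible set, the inexact optimality condition together with the four-point
  identity of the Bregman distance gives
  \<open>\<langle>C, X'\<^sub>k\<^sub>+\<^sub>1 - Y\<rangle> \<le> \<nu>\<^sub>k + \<eta>\<^sub>k \<parallel>X'\<^sub>k\<^sub>+\<^sub>1 - Y\<parallel> + \<epsilon>\<^sub>k (D(Y, X\<^sub>k) - D(Y, X\<^sub>k\<^sub>+\<^sub>1) + \<mu>\<^sub>k)\<close>.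
  If \<open>Y\<close> is optimal, the left-hand side is nonnegative, so \<open>D(Y, X\<^sub>k)\<close> is quasi-monotone and
  converges; the same inequality then forces \<open>\<langle>C, X'\<^sub>k\<rangle>\<close> to the optimal value. Hence a cluster point
  \<open>L\<close> of \<open>X'\<close> is optimal, \<open>D(L, X\<^sub>k)\<close> converges, and its limit is 0 since it is 0 along a
  subsequence. The Hellinger bound \<open>D(x, y) \<ge> (\<surd>x - \<surd>y)\<^sup>2\<close> turns smallness of Bregman distances
  into convergence of the tensors, also at the boundary of the orthant.\<close>

section \<open>Scalar relative entropy and its Hellinger bound\<close>

definition kl :: "real \<Rightarrow> real \<Rightarrow> real" where
  "kl x y = x * ln x - x * ln y - x + y"

text \<open>Apply \<open>ln u \<le> u - 1\<close> at \<open>u = sqrt (y / x)\<close> and multiply by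
  \<open>2 * x\<close>. The square root produces the full square; \<open>u = y / x\<close> would
  give only nonnegativity. For \<open>x = 0\<close> both sides equal \<open>y\<close>.\<close>

lemma kl_ge_hellinger:
  assumes "0 \<le> x" "0 < y"
  shows "(sqrt x - sqrt y)\<^sup>2 \<le> kl x y"
proof (cases "x = 0")
  case True
  then show ?thesis using assms by (simp add: kl_def)
next
  case False
  then have x: "0 < x" using assms by simp
  have "ln (sqrt (y / x)) \<le> sqrt (y / x) - 1"
    using x assms by (intro ln_le_minus_one) simp
  moreover have "ln (sqrt (y / x)) = (ln y - ln x) / 2"
    using x assms by (simp add: ln_sqrt ln_div)
  ultimately have "x * ((ln y - ln x) / 2) \<le> x * (sqrt (y / x) - 1)"
    using x by (simp add: mult_left_mono)
  moreover have "x * sqrt (y / x) = sqrt x * sqrt y"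
    using x assms by (simp add: real_sqrt_divide field_simps)
  moreover have "(sqrt x - sqrt y)\<^sup>2 = x + y - 2 * (sqrt x * sqrt y)"
    using x assms by (simp add: power2_diff)
  moreover have "x * ((ln y - ln x) / 2) = (x * ln y - x * ln x) / 2"
    by (simp add: algebra_simps)
  ultimately show ?thesis
    unfolding kl_def by (simp add: right_diff_distrib)
qed

lemma kl_nonneg:
  assumes "0 \<le> x" "0 < y"
  shows "0 \<le> kl x y"
  using kl_ge_hellinger[OF assms] zero_le_power2 order_trans by blast

text \<open>Factor \<open>y - x\<close> into the difference and the sum of the square roots. The
  Hellinger bound controls the difference by \<open>sqrt K\<close>, and hence \<open>sqrt y\<close>
  by \<open>sqrt B + sqrt K\<close>.\<close>

lemma abs_diff_le_kl:
  assumes "0 \<le> x" "0 < y" "x \<le> B" "kl x y \<le> K"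
  shows "\<bar>y - x\<bar> \<le> sqrt K * (2 * sqrt B + sqrt K)"
proof -
  define h where "h = \<bar>sqrt x - sqrt y\<bar>"
  have "h\<^sup>2 \<le> K"
    unfolding h_def using kl_ge_hellinger[of x y] assms by simp
  then have hK: "h \<le> sqrt K"
    by (rule real_le_rsqrt)
  have h0: "0 \<le> h" by (simp add: h_def)
  have K0: "0 \<le> K" using kl_nonneg[of x y] assms by linarith
  have xB: "sqrt x \<le> sqrt B" using assms by simp
  have "y - x = (sqrt y - sqrt x) * (sqrt y + sqrt x)"
    using assms by (simp add: algebra_simps)
  then have "\<bar>y - x\<bar> = h * (sqrt y + sqrt x)"
    using assms by (simp add: abs_mult h_def abs_minus_commute)
  also have "\<dots> \<le> sqrt K * (2 * sqrt B + sqrt K)"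
  proof (rule mult_mono)
    show "sqrt y + sqrt x \<le> 2 * sqrt B + sqrt K"
      using hK xB unfolding h_def by linarith
  qed (use hK h0 K0 assms in auto)
  finally show ?thesis .
qed

section \<open>The Bregman distance of the entropy on tensors\<close>

lemma entropy_bregman_eq_sum_kl:
  "entropy_bregman X Y = (\<Sum>r\<in>UNIV. \<Sum>s\<in>UNIV. \<Sum>t\<in>UNIV. kl (X $ r $ s $ t) (Y $ r $ s $ t))"
  unfolding entropy_bregman_def entropy_def entropy_grad_def inner_vec_def kl_def
    sum_subtractf[symmetric]
  by (intro sum.cong refl) (simp add: algebra_simps)

lemma kl_le_entropy_bregman:
  assumes X: "X \<in> nonneg_tensors" and Y: "Y \<in> pos_tensors"
  shows "kl (X $ r $ s $ t) (Y $ r $ s $ t) \<le> entropy_bregman X Y"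
proof -
  have pos: "0 \<le> kl (X $ r $ s $ t) (Y $ r $ s $ t)" for r s t
    using X Y by (auto simp: nonneg_tensors_def pos_tensors_def intro!: kl_nonneg)
  have "kl (X $ r $ s $ t) (Y $ r $ s $ t) \<le> (\<Sum>t\<in>UNIV. kl (X $ r $ s $ t) (Y $ r $ s $ t))"
    by (rule member_le_sum) (auto intro: pos)
  also have "\<dots> \<le> (\<Sum>s\<in>UNIV. \<Sum>t\<in>UNIV. kl (X $ r $ s $ t) (Y $ r $ s $ t))"
    by (rule member_le_sum) (auto intro!: pos sum_nonneg)
  also have "\<dots> \<le> (\<Sum>r\<in>UNIV. \<Sum>s\<in>UNIV. \<Sum>t\<in>UNIV. kl (X $ r $ s $ t) (Y $ r $ s $ t))"
    by (rule member_le_sum) (auto intro!: pos sum_nonneg)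
  finally show ?thesis
    by (simp add: entropy_bregman_eq_sum_kl)
qed

lemma entropy_bregman_nonneg:
  assumes "X \<in> nonneg_tensors" "Y \<in> pos_tensors"
  shows "0 \<le> entropy_bregman X Y"
  unfolding entropy_bregman_eq_sum_kl using assms
  by (auto simp: nonneg_tensors_def pos_tensors_def intro!: sum_nonneg kl_nonneg)

text \<open>All entropy values cancel, leaving only gradient terms. With \<open>V\<close>,
  \<open>W\<close> consecutive iterates and \<open>Z\<close> the feasible iterate, the right-hand
  side is a telescoping difference plus an error of at most \<open>\<mu> k\<close>.\<close>

lemma entropy_bregman_four_point:
  "(entropy_grad W - entropy_grad V) \<bullet> (Y - Z) =
     entropy_bregman Y V - entropy_bregman Y W - entropy_bregman Z V + entropy_bregman Z W"
  by (simp add: entropy_bregman_def inner_diff_left inner_diff_right)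

text \<open>Where an entry of \<open>L\<close> is positive, this is continuity of \<open>ln\<close>.
  Where it is 0, the logarithm of \<open>Y k\<close> may diverge, but its factor is 0 and
  \<open>kl 0 y = y\<close>.\<close>

lemma tendsto_entropy_bregman_self:
  assumes "L \<in> nonneg_tensors" "\<And>k. Y k \<in> pos_tensors" "Y \<longlonglongrightarrow> L"
  shows "(\<lambda>k. entropy_bregman L (Y k)) \<longlonglongrightarrow> 0"
proof -
  have "(\<lambda>k. kl (L $ r $ s $ t) (Y k $ r $ s $ t)) \<longlonglongrightarrow> 0" for r s t
  proof -
    have lim: "(\<lambda>k. Y k $ r $ s $ t) \<longlonglongrightarrow> L $ r $ s $ t"
      by (intro tendsto_intros assms)
    show ?thesis
    proof (cases "L $ r $ s $ t = 0")
      case True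
      then show ?thesis using lim by (simp add: kl_def)
    next
      case False
      have "(\<lambda>k. kl (L $ r $ s $ t) (Y k $ r $ s $ t)) \<longlonglongrightarrow> kl (L $ r $ s $ t) (L $ r $ s $ t)"
        unfolding kl_def by (intro tendsto_intros lim False)
      then show ?thesis by (simp add: kl_def)
    qed
  qed
  then show ?thesis
    unfolding entropy_bregman_eq_sum_kl
    by (intro tendsto_null_sum)
qed

text \<open>Each entry is controlled by \<open>abs_diff_le_kl\<close> with the Bregman distance as
  \<open>K\<close>; a bound on the first arguments suffices. It serves both for \<open>X'\<close>
  against \<open>X\<close> and for a constant first argument \<open>L\<close>.\<close>

lemma tendsto_diff_of_entropy_bregman:
  assumes X: "\<And>k. X k \<in> nonneg_tensors" and Y: "\<And>k. Y k \<in> pos_tensors"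
    and B: "\<And>k. norm (X k) \<le> B" and lim: "(\<lambda>k. entropy_bregman (X k) (Y k)) \<longlonglongrightarrow> 0"
  shows "(\<lambda>k. Y k - X k) \<longlonglongrightarrow> 0"
proof (intro vec_tendstoI)
  fix r s t
  have XB: "X k $ r $ s $ t \<le> B" for k
  proof -
    have "\<bar>X k $ r $ s $ t\<bar> \<le> norm (X k)"
      using component_le_norm_cart[of "X k $ r $ s" t]
        Finite_Cartesian_Product.norm_nth_le[of "X k $ r" s]
        Finite_Cartesian_Product.norm_nth_le[of "X k" r] by linarith
    then show ?thesis using B[of k] by linarith
  qed
  let ?K = "\<lambda>k. entropy_bregman (X k) (Y k)"
  have bound: "norm ((Y k - X k) $ r $ s $ t) \<le> sqrt (?K k) * (2 * sqrt B + sqrt (?K k))" for k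
    using abs_diff_le_kl[OF _ _ XB[of k] kl_le_entropy_bregman[OF X Y]] X[of k] Y[of k]
    by (simp add: nonneg_tensors_def pos_tensors_def)
  have "(\<lambda>k. sqrt (?K k) * (2 * sqrt B + sqrt (?K k))) \<longlonglongrightarrow> sqrt 0 * (2 * sqrt B + sqrt 0)"
    by (intro tendsto_intros lim)
  then have "(\<lambda>k. sqrt (?K k) * (2 * sqrt B + sqrt (?K k))) \<longlonglongrightarrow> 0"
    by simp
  then have "(\<lambda>k. (Y k - X k) $ r $ s $ t) \<longlonglongrightarrow> 0"
    by (rule Lim_null_comparison[OF always_eventually, rotated]) (rule allI, rule bound)
  then show "(\<lambda>k. (Y k - X k) $ r $ s $ t) \<longlonglongrightarrow> 0 $ r $ s $ t"
    by simp
qed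

text \<open>Subtracting the partial sums of \<open>e\<close> gives a decreasing sequence bounded
  below by \<open>- suminf e\<close>; the partial sums converge and can be added back.\<close>

lemma quasi_monotone_convergent:
  fixes a e :: "nat \<Rightarrow> real"
  assumes step: "\<And>k. a (Suc k) \<le> a k + e k" and a: "\<And>k. 0 \<le> a k" and e: "\<And>k. 0 \<le> e k"
    and sum: "summable e"
  shows "convergent a"
proof -
  have "convergent (\<lambda>k. a k - sum e {..<k})"
  proof (rule decseq_convergent)
    show "decseq (\<lambda>k. a k - sum e {..<k})"
      using step by (intro decseq_SucI) (simp add: algebra_simps)
    have "- suminf e \<le> a k - sum e {..<k}" for k
      using sum_le_suminf[OF sum, of "{..<k}"] e a[of k] by simp
    then show "\<forall>k. - suminf e \<le> a k - sum e {..<k}"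
      by blast
  qed (auto simp: convergent_def)
  moreover have "convergent (\<lambda>k. sum e {..<k})"
    using sum by (simp add: summable_iff_convergent)
  ultimately have "convergent (\<lambda>k. (a k - sum e {..<k}) + sum e {..<k})"
    by (rule convergent_add)
  then show ?thesis by simp
qed

section \<open>The feasible set and the inequality for one iteration\<close>

lemma closed_feasible:
  fixes U :: "ereal ^ 'n3::finite ^ 'n2::finite ^ 'n1::finite"
  shows "closed (feasible N m A b U)"
proof -
  have "feasible N m A b U =
     (\<Inter>i\<in>{1..N}. \<Inter>j\<in>{1..m i}. {X. A i j \<bullet> X = b i j}) \<inter>
     (\<Inter>r. \<Inter>s. \<Inter>t. {X. 0 \<le> X $ r $ s $ t}) \<inter>
     (\<Inter>r. \<Inter>s. \<Inter>t. {X. ereal (X $ r $ s $ t) \<le> U $ r $ s $ t})"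
    by (auto simp: feasible_def nonneg_tensors_def tensor_map_def)
  moreover have "closed {X. A i j \<bullet> X = b i j}" for i j
    by (intro closed_Collect_eq continuous_intros)
  moreover have "closed {X :: ('n1, 'n2, 'n3) tensor. 0 \<le> X $ r $ s $ t}" for r s t
    by (intro closed_Collect_le continuous_intros)
  moreover have "closed {X. ereal (X $ r $ s $ t) \<le> U $ r $ s $ t}" for r s t
    by (intro closed_Collect_le continuous_intros continuous_on_ereal)
  ultimately show ?thesis
    by (simp only:) (intro closed_Int closed_INT ballI)
qed

lemma feasible_subset_relaxed: "feasible N m A b U \<subseteq> relaxed_feasible N m A b U"
  by (auto simp: feasible_def relaxed_feasible_def)

lemma feasible_subset_nonneg: "feasible N m A b U \<subseteq> nonneg_tensors"
  by (auto simp: feasible_def)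

text \<open>Both indicator values are 0, so \<open>D\<close> is an approximate normal vector of
  \<open>S\<close> at \<open>X\<close>.\<close>

lemma approx_subdiff_set_indicatorD:
  assumes "D \<in> approx_subdiff \<nu> (set_indicator S) X" "X \<in> S" "Y \<in> S"
  shows "D \<bullet> (Y - X) \<le> \<nu>"
  using assms by (auto simp: approx_subdiff_def set_indicator_def dest: spec[of _ Y])

text \<open>Pair the residual with \<open>X' (Suc k) - Y\<close>: Cauchy-Schwarz yields the
  \<open>\<eta>\<close> term, the approximate normal \<open>D\<close> the \<open>\<nu>\<close> term,
  and the four-point identity the rest.\<close>

lemma iEPPA_step:
  assumes "iEPPA N m A b U C \<epsilon> \<nu> \<eta> \<mu> X X'" and Y: "Y \<in> feasible N m A b U" and "0 \<le> \<epsilon> k"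
  shows "C \<bullet> X' (Suc k) - C \<bullet> Y \<le> \<nu> k + \<eta> k * norm (X' (Suc k) - Y) +
     \<epsilon> k * (entropy_bregman Y (X k) - entropy_bregman Y (X (Suc k)) + \<mu> k)"
proof -
  let ?G = "entropy_grad (X (Suc k)) - entropy_grad (X k)"
  obtain D where D: "D \<in> approx_subdiff (\<nu> k) (set_indicator (relaxed_feasible N m A b U)) (X' (Suc k))"
    and \<eta>: "norm (D + C + \<epsilon> k *\<^sub>R ?G) \<le> \<eta> k"
    and \<mu>: "entropy_bregman (X' (Suc k)) (X (Suc k)) \<le> \<mu> k"
    and X': "X' (Suc k) \<in> feasible N m A b U"
    using assms(1) unfolding iEPPA_def by blast
  have Xk: "X k \<in> pos_tensors"
    using assms(1) unfolding iEPPA_def by (cases k) auto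
  have "D \<bullet> (Y - X' (Suc k)) \<le> \<nu> k"
    using approx_subdiff_set_indicatorD[OF D] X' Y feasible_subset_relaxed by blast
  moreover have "(D + C + \<epsilon> k *\<^sub>R ?G) \<bullet> (X' (Suc k) - Y) \<le> \<eta> k * norm (X' (Suc k) - Y)"
    using norm_cauchy_schwarz[of "D + C + \<epsilon> k *\<^sub>R ?G" "X' (Suc k) - Y"] \<eta>
    by (meson mult_right_mono norm_ge_zero order_trans)
  moreover have "(D + C + \<epsilon> k *\<^sub>R ?G) \<bullet> (X' (Suc k) - Y) =
      C \<bullet> X' (Suc k) - C \<bullet> Y - D \<bullet> (Y - X' (Suc k)) - \<epsilon> k * (?G \<bullet> (Y - X' (Suc k)))"
    by (simp add: inner_add_left inner_diff_right inner_diff_left algebra_simps)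
  \<comment> \<open>The term \<open>entropy_bregman (X' (Suc k)) (X k)\<close> enters with a minus
    sign and is dropped as nonnegative.\<close>
  moreover have "\<epsilon> k * (?G \<bullet> (Y - X' (Suc k))) \<le>
      \<epsilon> k * (entropy_bregman Y (X k) - entropy_bregman Y (X (Suc k)) + \<mu> k)"
    using entropy_bregman_nonneg[OF subsetD[OF feasible_subset_nonneg X'] Xk] \<mu>
    by (intro mult_left_mono \<open>0 \<le> \<epsilon> k\<close>) (simp add: entropy_bregman_four_point)
  ultimately show ?thesis by linarith
qed

section \<open>Convergence of the iterates\<close>

theorem theorem1:
  fixes C :: "('n1::finite, 'n2::finite, 'n3::finite) tensor"
    and U :: "ereal ^ 'n3 ^ 'n2 ^ 'n1"
    and N :: nat and m :: "nat \<Rightarrow> nat"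
    and A :: "nat \<Rightarrow> nat \<Rightarrow> ('n1, 'n2, 'n3) tensor"
    and b :: "nat \<Rightarrow> nat \<Rightarrow> real"
    and \<epsilon> \<nu> \<eta> \<mu> :: "nat \<Rightarrow> real"
    and \<epsilon>_lo \<epsilon>_hi :: real
    and X X' :: "nat \<Rightarrow> ('n1, 'n2, 'n3) tensor"
  assumes "(\<forall>r s t. 0 \<le> U $ r $ s $ t \<and> U $ r $ s $ t < \<infinity>) \<or> (\<forall>r s t. U $ r $ s $ t = \<infinity>)"
    and "\<forall>i\<in>{1..N}. \<forall>j\<in>{1..m i}. \<forall>r s t. A i j $ r $ s $ t \<in> {0, 1}"
    and "\<forall>i\<in>{1..N}. \<forall>j\<in>{1..m i}. \<forall>k\<in>{1..m i}. j \<noteq> k \<longrightarrow> A i j * A i k = 0"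
    and "bounded (feasible N m A b U)"
    and "feasible N m A b U \<inter> pos_tensors \<noteq> {}"
    and "\<forall>k. 0 \<le> \<epsilon> k" and "\<forall>k. 0 \<le> \<nu> k" and "\<forall>k. 0 \<le> \<eta> k" and "\<forall>k. 0 \<le> \<mu> k"
    and "iEPPA N m A b U C \<epsilon> \<nu> \<eta> \<mu> X X'"
    and "0 < \<epsilon>_lo" and "\<forall>k. \<epsilon>_lo \<le> \<epsilon> k \<and> \<epsilon> k \<le> \<epsilon>_hi"
    and "summable \<nu>" and "summable \<eta>" and "summable \<mu>"
  shows "\<exists>X_opt. is_arg_min (\<lambda>Y. C \<bullet> Y) (\<lambda>Y. Y \<in> feasible N m A b U) X_opt \<and>
           X \<longlonglongrightarrow> X_opt \<and> X' \<longlonglongrightarrow> X_opt"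
proof -
  let ?\<Omega> = "feasible N m A b U"
  let ?D = entropy_bregman
  note alg = \<open>iEPPA N m A b U C \<epsilon> \<nu> \<eta> \<mu> X X'\<close>
  have pos: "X k \<in> pos_tensors" for k
    using alg unfolding iEPPA_def by (cases k) auto
  \<comment> \<open>Only successor indices occur: the starting point \<open>X' 0\<close> is positive
    but may be infeasible.\<close>
  have X'\<Omega>: "X' (Suc k) \<in> ?\<Omega>" for k
    using alg unfolding iEPPA_def by blast
  have X'pos: "X' (Suc k) \<in> nonneg_tensors" for k
    using X'\<Omega> feasible_subset_nonneg by blast
  have \<mu>: "?D (X' (Suc k)) (X (Suc k)) \<le> \<mu> k" for k
    using alg unfolding iEPPA_def by blast
  have compact: "compact ?\<Omega>"
    using \<open>bounded ?\<Omega>\<close> closed_feasible by (simp add: compact_eq_bounded_closed)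
  obtain B where B: "\<And>Y. Y \<in> ?\<Omega> \<Longrightarrow> norm Y \<le> B"
    using \<open>bounded ?\<Omega>\<close> unfolding bounded_iff by blast
  have \<epsilon>: "\<epsilon>_lo \<le> \<epsilon> k" "\<epsilon> k \<le> \<epsilon>_hi" "0 \<le> \<epsilon> k" for k
    using \<open>\<forall>k. \<epsilon>_lo \<le> \<epsilon> k \<and> \<epsilon> k \<le> \<epsilon>_hi\<close> \<open>\<forall>k. 0 \<le> \<epsilon> k\<close> by auto
  \<comment> \<open>\<open>2 * B\<close> bounds the distance of two feasible points. The error
    \<open>\<mu> k\<close> stays apart because it carries the factor
    \<open>\<epsilon> k\<close>.\<close>
  define e where "e k = \<nu> k + \<eta> k * (2 * B)" for k
  have B0: "0 \<le> B" using B[OF X'\<Omega>] norm_ge_zero order_trans by blast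
  have e0: "0 \<le> e k" for k
    unfolding e_def using \<open>\<forall>k. 0 \<le> \<nu> k\<close> \<open>\<forall>k. 0 \<le> \<eta> k\<close> B0 by simp
  have e_sum: "summable e"
    unfolding e_def by (intro summable_add summable_mult2 \<open>summable \<nu>\<close> \<open>summable \<eta>\<close>)
  have step: "C \<bullet> X' (Suc k) - C \<bullet> Y \<le> e k + \<epsilon> k * (?D Y (X k) - ?D Y (X (Suc k)) + \<mu> k)"
    if Y: "Y \<in> ?\<Omega>" for Y k
  proof -
    have "norm (X' (Suc k) - Y) \<le> 2 * B"
      using norm_triangle_ineq4[of "X' (Suc k)" Y] B[OF X'\<Omega>[of k]] B[OF Y] by linarith
    then have "\<eta> k * norm (X' (Suc k) - Y) \<le> \<eta> k * (2 * B)"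
      using \<open>\<forall>k. 0 \<le> \<eta> k\<close> by (intro mult_left_mono) auto
    then show ?thesis
      using iEPPA_step[where k = k, OF alg Y \<epsilon>(3)] unfolding e_def by linarith
  qed

  \<comment> \<open>Stated for every minimizer, since it is applied first to some minimizer
    \<open>Y\<close> and later to the cluster point \<open>L\<close>. Dividing by
    \<open>\<epsilon> k \<ge> \<epsilon>_lo\<close> keeps the errors summable.\<close>
  have conv: "convergent (\<lambda>k. ?D Y (X k))"
    if Y: "Y \<in> ?\<Omega>" and opt: "\<And>Z. Z \<in> ?\<Omega> \<Longrightarrow> C \<bullet> Y \<le> C \<bullet> Z" for Y
  proof (rule quasi_monotone_convergent[where e = "\<lambda>k. e k / \<epsilon>_lo + \<mu> k"])
    show "?D Y (X (Suc k)) \<le> ?D Y (X k) + (e k / \<epsilon>_lo + \<mu> k)" for k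
    proof -
      have pos\<epsilon>: "0 < \<epsilon> k" using \<epsilon>(1)[of k] \<open>0 < \<epsilon>_lo\<close> by linarith
      have "0 \<le> e k + \<epsilon> k * (?D Y (X k) - ?D Y (X (Suc k)) + \<mu> k)"
        using step[OF Y, of k] opt[OF X'\<Omega>, of k] by linarith
      then have "0 \<le> e k / \<epsilon> k + (?D Y (X k) - ?D Y (X (Suc k)) + \<mu> k)"
        using pos\<epsilon> by (simp add: field_simps)
      moreover have "e k / \<epsilon> k \<le> e k / \<epsilon>_lo"
        using e0 \<epsilon>(1) \<open>0 < \<epsilon>_lo\<close> pos\<epsilon> by (intro divide_left_mono) auto
      ultimately show ?thesis by linarith
    qed
    show "0 \<le> ?D Y (X k)" for k
      using entropy_bregman_nonneg pos Y feasible_subset_nonneg by blast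
    show "0 \<le> e k / \<epsilon>_lo + \<mu> k" for k
      using e0 \<open>0 < \<epsilon>_lo\<close> \<open>\<forall>k. 0 \<le> \<mu> k\<close> by simp
    show "summable (\<lambda>k. e k / \<epsilon>_lo + \<mu> k)"
      by (intro summable_add summable_divide e_sum \<open>summable \<mu>\<close>)
  qed

  \<comment> \<open>This minimizer \<open>Y\<close> supplies the optimal value; it need not be the
    limit of the iterates.\<close>
  have "?\<Omega> \<noteq> {}"
    using X'\<Omega> by blast
  moreover have "continuous_on ?\<Omega> (\<lambda>Z. C \<bullet> Z)"
    by (intro continuous_intros)
  ultimately obtain Y where Y: "Y \<in> ?\<Omega>" and opt: "\<And>Z. Z \<in> ?\<Omega> \<Longrightarrow> C \<bullet> Y \<le> C \<bullet> Z"
    using continuous_attains_inf[OF compact] by blast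
  obtain d where d: "(\<lambda>k. ?D Y (X k)) \<longlonglongrightarrow> d"
    using conv[OF Y opt] unfolding convergent_def by blast
  define gap where "gap k = ?D Y (X k) - ?D Y (X (Suc k)) + \<mu> k" for k
  have gap_lim: "gap \<longlonglongrightarrow> 0"
    unfolding gap_def[abs_def]
    using tendsto_add[OF tendsto_diff[OF d LIMSEQ_Suc[OF d]] summable_LIMSEQ_zero[OF \<open>summable \<mu>\<close>]]
    by simp
  have value_lim: "(\<lambda>k. C \<bullet> X' (Suc k) - C \<bullet> Y) \<longlonglongrightarrow> 0"
  proof (rule Lim_null_comparison[OF always_eventually])
    \<comment> \<open>The sign of \<open>gap k\<close> is unknown, so it is replaced by its absolute
      value before \<open>\<epsilon> k\<close> is bounded by \<open>\<epsilon>_hi\<close>.\<close>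
    show "\<forall>k. norm (C \<bullet> X' (Suc k) - C \<bullet> Y) \<le> e k + \<epsilon>_hi * \<bar>gap k\<bar>"
    proof
      fix k
      have "\<epsilon> k * gap k \<le> \<epsilon> k * \<bar>gap k\<bar>"
        using \<epsilon>(3) by (intro mult_left_mono) auto
      also have "\<dots> \<le> \<epsilon>_hi * \<bar>gap k\<bar>"
        using \<epsilon>(2) by (intro mult_right_mono) auto
      finally show "norm (C \<bullet> X' (Suc k) - C \<bullet> Y) \<le> e k + \<epsilon>_hi * \<bar>gap k\<bar>"
        using step[OF Y, of k] opt[OF X'\<Omega>, of k] unfolding gap_def real_norm_def by linarith
    qed
    show "(\<lambda>k. e k + \<epsilon>_hi * \<bar>gap k\<bar>) \<longlonglongrightarrow> 0"
      using tendsto_add[OF summable_LIMSEQ_zero[OF e_sum]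
          tendsto_mult_left[OF tendsto_rabs[OF gap_lim], of \<epsilon>_hi]] by simp
  qed

  obtain L \<sigma> where L: "L \<in> ?\<Omega>" and \<sigma>: "strict_mono \<sigma>"
    and X'_sub: "(\<lambda>j. X' (Suc (\<sigma> j))) \<longlonglongrightarrow> L"
    using seq_compactE[OF compact[unfolded compact_eq_seq_compact_metric], of "\<lambda>k. X' (Suc k)"]
      X'\<Omega> by (auto simp: o_def)
  have "(\<lambda>j. C \<bullet> X' (Suc (\<sigma> j)) - C \<bullet> Y) \<longlonglongrightarrow> C \<bullet> L - C \<bullet> Y"
    by (intro tendsto_intros X'_sub)
  moreover have "(\<lambda>j. C \<bullet> X' (Suc (\<sigma> j)) - C \<bullet> Y) \<longlonglongrightarrow> 0"
    using LIMSEQ_subseq_LIMSEQ[OF value_lim \<sigma>] by (simp add: o_def)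
  ultimately have "C \<bullet> L - C \<bullet> Y = 0"
    by (rule LIMSEQ_unique)
  then have L_opt: "\<And>Z. Z \<in> ?\<Omega> \<Longrightarrow> C \<bullet> L \<le> C \<bullet> Z"
    using opt by simp
  have L_nonneg: "L \<in> nonneg_tensors"
    using L feasible_subset_nonneg by blast

  \<comment> \<open>These distances lie between 0 and \<open>\<mu> k\<close>, so \<open>X\<close>
    inherits the cluster point \<open>L\<close> from \<open>X'\<close>.\<close>
  have "(\<lambda>k. ?D (X' (Suc k)) (X (Suc k))) \<longlonglongrightarrow> 0"
    by (rule tendsto_sandwich[OF _ _ tendsto_const summable_LIMSEQ_zero[OF \<open>summable \<mu>\<close>]])
      (auto intro!: always_eventually entropy_bregman_nonneg X'pos pos \<mu>)
  then have diff_lim: "(\<lambda>k. X (Suc k) - X' (Suc k)) \<longlonglongrightarrow> 0"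
    by (intro tendsto_diff_of_entropy_bregman[where B = B] X'pos pos B X'\<Omega>)
  have "(\<lambda>j. (X (Suc (\<sigma> j)) - X' (Suc (\<sigma> j))) + X' (Suc (\<sigma> j))) \<longlonglongrightarrow> 0 + L"
    using LIMSEQ_subseq_LIMSEQ[OF diff_lim \<sigma>] by (intro tendsto_add X'_sub) (simp add: o_def)
  then have "(\<lambda>j. ?D L (X (Suc (\<sigma> j)))) \<longlonglongrightarrow> 0"
    by (intro tendsto_entropy_bregman_self L_nonneg pos) simp
  \<comment> \<open>Optimality of \<open>L\<close> makes the whole sequence of distances converge,
    so its limit must be the subsequence limit 0.\<close>
  moreover obtain d' where d': "(\<lambda>k. ?D L (X k)) \<longlonglongrightarrow> d'"
    using conv[OF L L_opt] unfolding convergent_def by blast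
  then have "(\<lambda>j. ?D L (X (Suc (\<sigma> j)))) \<longlonglongrightarrow> d'"
    using LIMSEQ_subseq_LIMSEQ[OF LIMSEQ_Suc[OF d'] \<sigma>] by (simp add: o_def)
  ultimately have "(\<lambda>k. ?D L (X k)) \<longlonglongrightarrow> 0"
    using d' LIMSEQ_unique by blast
  then have "(\<lambda>k. X k - L) \<longlonglongrightarrow> 0"
    by (intro tendsto_diff_of_entropy_bregman[where B = B] L_nonneg pos B L)
  then have X_lim: "X \<longlonglongrightarrow> L"
    by (simp add: LIM_zero_iff)
  have "(\<lambda>k. X (Suc k) - (X (Suc k) - X' (Suc k))) \<longlonglongrightarrow> L - 0"
    by (intro tendsto_diff LIMSEQ_Suc[OF X_lim] diff_lim)
  then have "X' \<longlonglongrightarrow> L"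
    by (subst filterlim_sequentially_Suc[symmetric]) simp
  moreover have "is_arg_min (\<lambda>Y. C \<bullet> Y) (\<lambda>Y. Y \<in> ?\<Omega>) L"
    using L L_opt unfolding is_arg_min_def by (auto simp: not_less)
  ultimately show ?thesis
    using X_lim by blast
qed

end
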